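(* Let $\lambda\in\mathbb R$ and let $\gamma(t)=\Psi(u(t),v(t))$, $t\in[a,b]$, be a smooth non-degenerate curve in $(\mathbb S_1^2)_{y-z}^+=\{(x,y,z)\in\mathbb S_1^2:y-z>0\}$ with $\cosh(u)\sin(v)-\sinh(u)+\lambda\neq0$ along $\gamma$. Then $\gamma$ is a catenary with respect to the plane $\Pi_{y-z}=\{y-z=0\}$ (with Lagrange multiplier $\lambda$) if and only if its curvature $\kappa$ satisfies $$\kappa=-\frac{v'\cosh(u)\,(\sinh(u)\sin(v)-\cosh(u))+u'\cos(v)}{(\cosh(u)\sin(v)-\sinh(u)+\lambda)\,|\gamma'|}.$$
   Context: $\mathbb L^3$ is $\mathbb R^3$ with the metric $\langle\,,\rangle=(dx)^2+(dy)^2-(dz)^2$, and $\mathbb S_1^2=\{(x,y,z):x^2+y^2-z^2=1\}$ with the induced metric, parametrized by $\Psi\colon\mathbb R^2\to\mathbb S_1^2$, $\Psi(u,v)=(\cosh(u)\cos v,\cosh(u)\sin v,\sinh(u))$. A curve $\gamma$ is non-degenerate if it is spacelike ($\langle\gamma',\gamma'\rangle>0$ everywhere; $\epsilon=1$) or timelike ($\langle\gamma',\gamma'\rangle<0$ everywhere; $\epsilon=-1$). For $\gamma(t)=\Psi(u(t),v(t))$ one has $|\gamma'|=\sqrt{\epsilon\langle\gamma',\gamma'\rangle}=\sqrt{\epsilon(v'^2\cosh(u)^2-u'^2)}$. The (geodesic) curvature of $\gamma$ in $\mathbb S_1^2$ is $\kappa=\epsilon\,\dfrac{\langle\gamma'',\gamma'\times\xi(\gamma)\rangle}{|\gamma'|^3}=\epsilon\,\dfrac{\det(\gamma,\gamma',\gamma'')}{|\gamma'|^3}$,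 where $\xi(p)=-p$ and $\times$ is the Lorentzian cross product, $\langle a\times b,c\rangle=\det(a,b,c)$. The distance of a point $(x,y,z)\in(\mathbb S_1^2)_{y-z}^+$ to $\Pi_{y-z}$ is taken to be $y-z$ (ignoring a constant factor $\sqrt2$). A catenary with respect to $\Pi_{y-z}$ with Lagrange multiplier $\lambda$ is a critical point, among curves in $(\mathbb S_1^2)_{y-z}^+$ with the same endpoints, of $$\mathcal E_{y-z}[\gamma]=\int_a^b(\cosh(u)\sin(v)-\sinh(u)+\lambda)\sqrt{\epsilon(v'^2\cosh(u)^2-u'^2)}\,dt,$$ i.e. a solution of its Euler-Lagrange equations. *)

theory Defs
  imports "HOL-Analysis.Analysis"
begin

section \<open>Lorentz-Minkowski space and the de Sitter sphere\<close>

definition lorentz :: "real^3 \<Rightarrow> real^3 \<Rightarrow> real" where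
  "lorentz p q = p$1 * q$1 + p$2 * q$2 - p$3 * q$3"

text \<open>The Euclidean cross product with its last component negated, so that
  \<open>lorentz_cross_det\<close> below holds.\<close>

definition lorentz_cross :: "real^3 \<Rightarrow> real^3 \<Rightarrow> real^3" where
  "lorentz_cross p q = vector [p$2 * q$3 - p$3 * q$2, p$3 * q$1 - p$1 * q$3,
                               p$2 * q$1 - p$1 * q$2]"

lemma lorentz_cross_det:
  "lorentz (lorentz_cross p q) r = det (vector [p, q, r] :: real^3^3)"
  by (simp add: lorentz_def lorentz_cross_def det_3 algebra_simps)

definition de_sitter :: "(real^3) set" where
  "de_sitter = {p. (p$1)\<^sup>2 + (p$2)\<^sup>2 - (p$3)\<^sup>2 = 1}"

definition de_sitter_yz_pos :: "(real^3) set" where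
  "de_sitter_yz_pos = {p \<in> de_sitter. p$2 - p$3 > 0}"

definition Psi :: "real \<Rightarrow> real \<Rightarrow> real^3" where
  "Psi u v = vector [cosh u * cos v, cosh u * sin v, sinh u]"

lemma Psi_in_de_sitter: "Psi u v \<in> de_sitter"
proof -
  have "(cosh u * cos v)\<^sup>2 + (cosh u * sin v)\<^sup>2 = (cosh u)\<^sup>2 * ((cos v)\<^sup>2 + (sin v)\<^sup>2)"
    by (simp only: power_mult_distrib distrib_left)
  then show ?thesis
    by (simp add: de_sitter_def Psi_def cosh_square_eq)
qed

definition xi :: "real^3 \<Rightarrow> real^3" where
  "xi p = - p"


section \<open>Curves on a compact interval\<close>

text \<open>Derivatives are taken within \<open>{a..b}\<close>, hence are one-sided at the endpoints.\<close>

definition cderiv :: "real \<Rightarrow> real \<Rightarrow> (real \<Rightarrow> 'a::real_normed_vector) \<Rightarrow> real \<Rightarrow> 'a" where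
  "cderiv a b f t = vector_derivative f (at t within {a..b})"

definition smooth1 :: "real \<Rightarrow> real \<Rightarrow> (real \<Rightarrow> real) \<Rightarrow> bool" where
  "smooth1 a b f \<longleftrightarrow> (\<exists>D :: nat \<Rightarrow> real \<Rightarrow> real.
     (\<forall>t\<in>{a..b}. D 0 t = f t) \<and>
     (\<forall>n. \<forall>t\<in>{a..b}. (D n has_real_derivative D (Suc n) t) (at t within {a..b})))"

text \<open>Joint smoothness of \<open>F\<close> on \<open>S \<times> {a..b}\<close> for open \<open>S\<close>: \<open>D i j\<close> is the partial
  derivative of \<open>F\<close> of order \<open>i\<close> in the first and \<open>j\<close> in the second variable. All of them
  exist and are continuous; that mixed partials do not depend on the order of
  differentiation is no restriction, by the symmetry of continuous mixed partials.\<close>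

definition smooth2 :: "real set \<Rightarrow> real \<Rightarrow> real \<Rightarrow> (real \<Rightarrow> real \<Rightarrow> real) \<Rightarrow> bool" where
  "smooth2 S a b F \<longleftrightarrow> (\<exists>D :: nat \<Rightarrow> nat \<Rightarrow> real \<Rightarrow> real \<Rightarrow> real.
     (\<forall>s\<in>S. \<forall>t\<in>{a..b}. D 0 0 s t = F s t) \<and>
     (\<forall>i j. continuous_on (S \<times> {a..b}) (\<lambda>(s, t). D i j s t) \<and>
        (\<forall>s\<in>S. \<forall>t\<in>{a..b}.
          ((\<lambda>x. D i j x t) has_real_derivative D (Suc i) j s t) (at s within S) \<and>
          ((\<lambda>y. D i j s y) has_real_derivative D i (Suc j) s t) (at t within {a..b}))))"

definition spacelike :: "real \<Rightarrow> real \<Rightarrow> (real \<Rightarrow> real^3) \<Rightarrow> bool" where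
  "spacelike a b \<gamma> \<longleftrightarrow> (\<forall>t\<in>{a..b}. lorentz (cderiv a b \<gamma> t) (cderiv a b \<gamma> t) > 0)"

definition timelike :: "real \<Rightarrow> real \<Rightarrow> (real \<Rightarrow> real^3) \<Rightarrow> bool" where
  "timelike a b \<gamma> \<longleftrightarrow> (\<forall>t\<in>{a..b}. lorentz (cderiv a b \<gamma> t) (cderiv a b \<gamma> t) < 0)"

definition nondegenerate :: "real \<Rightarrow> real \<Rightarrow> real \<Rightarrow> (real \<Rightarrow> real^3) \<Rightarrow> bool" where
  "nondegenerate a b \<epsilon> \<gamma> \<longleftrightarrow> \<epsilon> = 1 \<and> spacelike a b \<gamma> \<or> \<epsilon> = -1 \<and> timelike a b \<gamma>"

definition speed :: "real \<Rightarrow> real \<Rightarrow> real \<Rightarrow> (real \<Rightarrow> real^3) \<Rightarrow> real \<Rightarrow> real" where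
  "speed a b \<epsilon> \<gamma> t = sqrt (\<epsilon> * lorentz (cderiv a b \<gamma> t) (cderiv a b \<gamma> t))"

definition curvature :: "real \<Rightarrow> real \<Rightarrow> real \<Rightarrow> (real \<Rightarrow> real^3) \<Rightarrow> real \<Rightarrow> real" where
  "curvature a b \<epsilon> \<gamma> t =
     \<epsilon> * lorentz (cderiv a b (cderiv a b \<gamma>) t) (lorentz_cross (cderiv a b \<gamma> t) (xi (\<gamma> t)))
       / (speed a b \<epsilon> \<gamma> t) ^ 3"

lemma curvature_det:
  "curvature a b \<epsilon> \<gamma> t =
     \<epsilon> * det (vector [\<gamma> t, cderiv a b \<gamma> t, cderiv a b (cderiv a b \<gamma>) t] :: real^3^3)
       / (speed a b \<epsilon> \<gamma> t) ^ 3"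
proof -
  have "lorentz r (lorentz_cross q (xi p)) = det (vector [p, q, r] :: real^3^3)" for p q r
    by (simp add: lorentz_def lorentz_cross_def xi_def det_3 algebra_simps)
  then show ?thesis by (simp add: curvature_def)
qed


section \<open>Catenaries\<close>

definition energy ::
  "real \<Rightarrow> real \<Rightarrow> real \<Rightarrow> real \<Rightarrow> (real \<Rightarrow> real) \<Rightarrow> (real \<Rightarrow> real) \<Rightarrow> real" where
  "energy lam a b \<epsilon> u v = integral {a..b} (\<lambda>t.
     (cosh (u t) * sin (v t) - sinh (u t) + lam) *
     sqrt (\<epsilon> * ((cderiv a b v t)\<^sup>2 * (cosh (u t))\<^sup>2 - (cderiv a b u t)\<^sup>2)))"

lemma cderiv_Psi:
  assumes "a < b" "t \<in> {a..b}"
    and "(u has_real_derivative u') (at t within {a..b})"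
    and "(v has_real_derivative v') (at t within {a..b})"
  shows "cderiv a b (\<lambda>t. Psi (u t) (v t)) t =
    vector [sinh (u t) * u' * cos (v t) - cosh (u t) * sin (v t) * v',
            sinh (u t) * u' * sin (v t) + cosh (u t) * cos (v t) * v',
            cosh (u t) * u']" (is "_ = ?w")
proof -
  have e: "Psi x y = (cosh x * cos y) *\<^sub>R axis 1 1 + (cosh x * sin y) *\<^sub>R axis 2 1
      + sinh x *\<^sub>R axis 3 1" for x y
    by (simp add: Psi_def vec_eq_iff forall_3 axis_def)
  have "((\<lambda>t. (cosh (u t) * cos (v t)) *\<^sub>R (axis 1 1 :: real^3)
         + (cosh (u t) * sin (v t)) *\<^sub>R axis 2 1 + sinh (u t) *\<^sub>R axis 3 1)
      has_vector_derivative
       (sinh (u t) * u' * cos (v t) - cosh (u t) * sin (v t) * v') *\<^sub>R axis 1 1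
       + (sinh (u t) * u' * sin (v t) + cosh (u t) * cos (v t) * v') *\<^sub>R axis 2 1
       + (cosh (u t) * u') *\<^sub>R axis 3 1) (at t within {a..b})"
    by (rule derivative_eq_intros assms refl
        | simp add: algebra_simps)+
  then have "((\<lambda>t. Psi (u t) (v t)) has_vector_derivative ?w) (at t within {a..b})"
    unfolding e
    by (rule has_vector_derivative_eq_rhs) (simp add: vec_eq_iff forall_3 axis_def)
  then show ?thesis
    unfolding cderiv_def using assms by (intro vector_derivative_within_closed_interval) auto
qed

text \<open>The energy of a coordinate curve is the weighted length of the curve it parametrizes.\<close>

lemma energy_Psi:
  assumes "a < b" "smooth1 a b u" "smooth1 a b v"
  shows "energy lam a b \<epsilon> u v = integral {a..b} (\<lambda>t.
    ((Psi (u t) (v t))$2 - (Psi (u t) (v t))$3 + lam) * speed a b \<epsilon> (\<lambda>t. Psi (u t) (v t)) t)"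
proof -
  have d: "(f has_real_derivative cderiv a b f t) (at t within {a..b})"
    if f: "smooth1 a b f" and t: "t \<in> {a..b}" for f t
  proof -
    obtain D where D: "\<forall>t\<in>{a..b}. D 0 t = f t"
      "\<forall>n. \<forall>t\<in>{a..b}. (D n has_real_derivative D (Suc n) t) (at t within {a..b})"
      using f unfolding smooth1_def by blast
    have "(D 0 has_real_derivative D (Suc 0) t) (at t within {a..b})" using D t by blast
    then have "(f has_real_derivative D (Suc 0) t) (at t within {a..b})"
      by (rule has_field_derivative_transform_within[OF _ zero_less_one t]) (use D t in auto)
    moreover from this have "cderiv a b f t = D (Suc 0) t"
      unfolding cderiv_def using t assms(1)
      by (intro vector_derivative_within_closed_interval)
         (auto simp: has_real_derivative_iff_has_vector_derivative)
    ultimately show ?thesis by simp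
  qed
  have key: "lorentz w w = q\<^sup>2 * (cosh x)\<^sup>2 - p\<^sup>2"
    if "w = vector [sinh x * p * cos y - cosh x * sin y * q,
            sinh x * p * sin y + cosh x * cos y * q, cosh x * p]" for w x y p q
  proof -
    have "lorentz w w = (sinh x * p)\<^sup>2 * ((cos y)\<^sup>2 + (sin y)\<^sup>2)
        + (cosh x * q)\<^sup>2 * ((cos y)\<^sup>2 + (sin y)\<^sup>2) - (cosh x * p)\<^sup>2"
      by (simp add: that lorentz_def power2_eq_square algebra_simps
          del: sin_cos_squared_add sin_cos_squared_add2 sin_cos_squared_add3)
    then show ?thesis by (simp add: cosh_square_eq power_mult_distrib algebra_simps)
  qed
  have "speed a b \<epsilon> (\<lambda>t. Psi (u t) (v t)) t =
      sqrt (\<epsilon> * ((cderiv a b v t)\<^sup>2 * (cosh (u t))\<^sup>2 - (cderiv a b u t)\<^sup>2))"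
    if "t \<in> {a..b}" for t
    unfolding speed_def
    by (subst key[OF cderiv_Psi[OF assms(1) that d[OF assms(2) that] d[OF assms(3) that]]]) simp
  then show ?thesis
    unfolding energy_def by (intro integral_cong) (simp add: Psi_def)
qed

definition admissible ::
  "real \<Rightarrow> real \<Rightarrow> real \<Rightarrow> (real \<Rightarrow> real) \<Rightarrow> (real \<Rightarrow> real) \<Rightarrow> bool" where
  "admissible a b \<epsilon> u v \<longleftrightarrow> smooth1 a b u \<and> smooth1 a b v \<and>
     (\<forall>t\<in>{a..b}. Psi (u t) (v t) \<in> de_sitter_yz_pos) \<and>
     nondegenerate a b \<epsilon> (\<lambda>t. Psi (u t) (v t))"

text \<open>A smooth one-parameter family of curves with the same endpoints, in coordinates. Since
  \<open>Psi\<close> is a covering map, a family of curves on the surface with fixed endpoints lifts to a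
  family in the \<open>(u, v)\<close>-plane with fixed endpoints, so working in coordinates loses no
  generality.\<close>

definition variation ::
  "real \<Rightarrow> real \<Rightarrow> real \<Rightarrow> (real \<Rightarrow> real) \<Rightarrow> (real \<Rightarrow> real) \<Rightarrow> real \<Rightarrow>
   (real \<Rightarrow> real \<Rightarrow> real) \<Rightarrow> (real \<Rightarrow> real \<Rightarrow> real) \<Rightarrow> bool" where
  "variation a b \<epsilon> u v \<delta> U V \<longleftrightarrow> \<delta> > 0 \<and>
     smooth2 {-\<delta><..<\<delta>} a b U \<and> smooth2 {-\<delta><..<\<delta>} a b V \<and>
     (\<forall>t\<in>{a..b}. U 0 t = u t \<and> V 0 t = v t) \<and>
     (\<forall>s\<in>{-\<delta><..<\<delta>}. U s a = u a \<and> V s a = v a \<and> U s b = u b \<and> V s b = v b \<and>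
        admissible a b \<epsilon> (U s) (V s))"

definition catenary_yz ::
  "real \<Rightarrow> real \<Rightarrow> real \<Rightarrow> real \<Rightarrow> (real \<Rightarrow> real) \<Rightarrow> (real \<Rightarrow> real) \<Rightarrow> bool" where
  "catenary_yz lam a b \<epsilon> u v \<longleftrightarrow> admissible a b \<epsilon> u v \<and>
     (\<forall>\<delta> U V. variation a b \<epsilon> u v \<delta> U V \<longrightarrow>
        ((\<lambda>s. energy lam a b \<epsilon> (U s) (V s)) has_real_derivative 0) (at 0))"

end

theory Submission
  imports Defs
begin

text \<open>The energy is invariant under reparametrization, so its two Euler-Lagrange expressions are
  \<open>v' K\<close> and \<open>- u' K\<close> for a single function \<open>K\<close>. An explicit computation gives
  \<open>K = \<epsilon> cosh(u) h (\<kappa> - \<kappa>\<^sub>0)\<close>, where \<open>h\<close> is the weight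
  \<open>cosh(u) sin(v) - sinh(u) + \<lambda>\<close> and \<open>\<kappa>\<^sub>0\<close> is the curvature claimed in the theorem; since
  \<open>(u', v')\<close> never vanishes, the Euler-Lagrange equations amount to \<open>\<kappa> = \<kappa>\<^sub>0\<close>. That a critical
  point satisfies them is tested on the variations \<open>u + s f\<close>, \<open>v + s g\<close> with polynomials \<open>f\<close>, \<open>g\<close>
  vanishing at the endpoints, which suffice by the Weierstrass approximation theorem.\<close>

section \<open>Smooth functions on an interval\<close>

lemma cderiv_eq:
  fixes f :: "real \<Rightarrow> 'a::euclidean_space"
  assumes "a < b" "t \<in> {a..b}" "(f has_vector_derivative f') (at t within {a..b})"
  shows "cderiv a b f t = f'"
  unfolding cderiv_def using assms by (rule vector_derivative_within_closed_interval)

lemma cderiv_real_eq: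
  assumes "a < b" "t \<in> {a..b}" "(f has_real_derivative f') (at t within {a..b})"
  shows "cderiv a b f t = f'"
  using assms by (intro cderiv_eq) (auto simp: has_real_derivative_iff_has_vector_derivative)

text \<open>\<open>vector_derivative\<close> is a choice from the predicate
  \<open>has_vector_derivative\<close>. Functions that agree on the interval satisfy the same
  predicate there, so the choices coincide even where no derivative exists.\<close>

lemma cderiv_cong:
  assumes "t \<in> {a..b}" "\<And>t. t \<in> {a..b} \<Longrightarrow> f t = g t"
  shows "cderiv a b f t = cderiv a b g t"
proof -
  have "(f has_vector_derivative d) (at t within {a..b}) \<longleftrightarrow>
      (g has_vector_derivative d) (at t within {a..b})" for d
    using assms has_vector_derivative_transform[of t "{a..b}"] by (metis (no_types, lifting))
  then show ?thesis by (simp add: cderiv_def vector_derivative_def)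
qed

lemma smooth1_DERIV:
  assumes "a < b" "smooth1 a b f" "t \<in> {a..b}"
  shows "(f has_real_derivative cderiv a b f t) (at t within {a..b})"
proof -
  obtain D where D: "\<forall>t\<in>{a..b}. D 0 t = f t"
    "\<forall>n. \<forall>t\<in>{a..b}. (D n has_real_derivative D (Suc n) t) (at t within {a..b})"
    using assms(2) unfolding smooth1_def by blast
  then have "(f has_real_derivative D (Suc 0) t) (at t within {a..b})"
    using assms(3) by (intro has_field_derivative_transform_within[of "D 0" _ t _ 1 f]) auto
  then show ?thesis using assms cderiv_real_eq by simp
qed

text \<open>The witness sequence shifted by one serves again, because its new first member agrees
  with \<open>cderiv a b f\<close> on the interval.\<close>

lemma smooth1_cderiv:
  assumes "a < b" "smooth1 a b f"
  shows "smooth1 a b (cderiv a b f)"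
proof -
  obtain D where D: "\<forall>t\<in>{a..b}. D 0 t = f t"
    "\<forall>n. \<forall>t\<in>{a..b}. (D n has_real_derivative D (Suc n) t) (at t within {a..b})"
    using assms(2) unfolding smooth1_def by blast
  have "D (Suc 0) t = cderiv a b f t" if "t \<in> {a..b}" for t
  proof -
    have "cderiv a b f t = cderiv a b (D 0) t" using D that by (intro cderiv_cong) auto
    also have "\<dots> = D (Suc 0) t" using assms(1) that D by (intro cderiv_real_eq) auto
    finally show ?thesis ..
  qed
  then show ?thesis
    unfolding smooth1_def using D by (intro exI[of _ "\<lambda>n. D (Suc n)"]) auto
qed

lemma smooth1_continuous_on:
  assumes "a < b" "smooth1 a b f"
  shows "continuous_on {a..b} f"
  by (rule DERIV_continuous_on) (use assms smooth1_DERIV in auto)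

lemma smooth1_add_scaled:
  assumes "smooth1 a b f" "smooth1 a b g"
  shows "smooth1 a b (\<lambda>t. f t + c * g t)"
proof -
  obtain D where D: "\<forall>t\<in>{a..b}. D 0 t = f t"
    "\<forall>n. \<forall>t\<in>{a..b}. (D n has_real_derivative D (Suc n) t) (at t within {a..b})"
    using assms(1) unfolding smooth1_def by blast
  obtain E where E: "\<forall>t\<in>{a..b}. E 0 t = g t"
    "\<forall>n. \<forall>t\<in>{a..b}. (E n has_real_derivative E (Suc n) t) (at t within {a..b})"
    using assms(2) unfolding smooth1_def by blast
  show ?thesis unfolding smooth1_def
    by (rule exI[of _ "\<lambda>n t. D n t + c * E n t"])
       (use D E in \<open>auto intro!: derivative_intros DERIV_cmult\<close>)
qed

section \<open>Polynomial test functions and the fundamental lemma of the calculus of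
  variations\<close>

lemma smooth1_polynomial:
  assumes "real_polynomial_function p"
  shows "smooth1 a b p"
proof -
  \<comment> \<open>The derivative of a polynomial is a polynomial, so dependent choice produces all
    successive derivatives at once; the clause for \<open>n = 0\<close> makes the sequence start at
    \<open>p\<close>.\<close>
  have "\<exists>D. \<forall>n. (real_polynomial_function (D n) \<and> (n = 0 \<longrightarrow> D n = p)) \<and>
      (\<forall>x. (D n has_real_derivative D (Suc n) x) (at x))"
    by (rule dependent_nat_choice)
       (use assms has_real_derivative_polynomial_function in blast)+
  then obtain D where "\<forall>n. (real_polynomial_function (D n) \<and> (n = 0 \<longrightarrow> D n = p)) \<and>
      (\<forall>x. (D n has_real_derivative D (Suc n) x) (at x))" by blast
  then show ?thesis unfolding smooth1_def
    by (intro exI[of _ D]) (auto intro: has_field_derivative_at_within)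
qed

lemma smooth2_linear:
  assumes "a < b" "smooth1 a b f" "smooth1 a b g"
  shows "smooth2 S a b (\<lambda>s t. f t + s * g t)"
proof -
  obtain D where D: "\<forall>t\<in>{a..b}. D 0 t = f t"
    "\<And>n t. t \<in> {a..b} \<Longrightarrow> (D n has_real_derivative D (Suc n) t) (at t within {a..b})"
    using assms(2) unfolding smooth1_def by blast
  obtain E where E: "\<forall>t\<in>{a..b}. E 0 t = g t"
    "\<And>n t. t \<in> {a..b} \<Longrightarrow> (E n has_real_derivative E (Suc n) t) (at t within {a..b})"
    using assms(3) unfolding smooth1_def by blast
  have cD: "continuous_on {a..b} (D n)" and cE: "continuous_on {a..b} (E n)" for n
    by (rule DERIV_continuous_on, erule D(2)) (rule DERIV_continuous_on, erule E(2))
  have c: "continuous_on (S \<times> {a..b}) (\<lambda>x. D n (snd x))"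
    "continuous_on (S \<times> {a..b}) (\<lambda>x. E n (snd x))" for n
    by (rule continuous_on_compose2[OF cD continuous_on_snd[OF continuous_on_id]]; auto)
       (rule continuous_on_compose2[OF cE continuous_on_snd[OF continuous_on_id]]; auto)
  \<comment> \<open>The family is affine in s: without an s derivative it is \<open>D j\<close> plus
    s times \<open>E j\<close>, one s derivative leaves \<open>E j\<close>, and any further one
    gives zero.\<close>
  define F where "F i j s t = (if i = 0 then D j t + s * E j t else if i = 1 then E j t else 0)"
    for i j :: nat and s t
  have "continuous_on (S \<times> {a..b}) (\<lambda>(s, t). F i j s t)" for i j
    by (cases "i = 0"; cases "i = 1")
       (auto simp: F_def split_beta intro!: continuous_intros c)
  moreover have "((\<lambda>x. F i j x t) has_real_derivative F (Suc i) j s t) (at s within S)" for i j s t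
    by (auto simp: F_def intro!: derivative_eq_intros)
  moreover have "((\<lambda>y. F i j s y) has_real_derivative F i (Suc j) s t) (at t within {a..b})"
    if "t \<in> {a..b}" for i j s t
    using D(2)[OF that] E(2)[OF that]
    by (auto simp: F_def intro!: derivative_intros DERIV_cmult)
  moreover have "F 0 0 s t = f t + s * g t" if "t \<in> {a..b}" for s t
    using D(1) E(1) that by (simp add: F_def)
  ultimately show ?thesis
    unfolding smooth2_def by (intro exI[of _ F]) auto
qed

text \<open>A Weierstrass approximation of \<open>f\<close>, multiplied by a weight that vanishes at
  the endpoints, is an allowed test function. Orthogonality to it forces the weighted square of
  \<open>f\<close> to have integral zero as the approximation improves.\<close>

lemma polynomial_orthogonal_imp_zero:
  fixes f :: "real \<Rightarrow> real"
  assumes "a < b" "continuous_on {a..b} f"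
    and orth: "\<And>p. real_polynomial_function p \<Longrightarrow> p a = 0 \<Longrightarrow> p b = 0 \<Longrightarrow>
      integral {a..b} (\<lambda>t. f t * p t) = 0"
    and "t \<in> {a..b}"
  shows "f t = 0"
proof -
  \<comment> \<open>Positive inside and zero at both ends: \<open>m\<close> turns every polynomial
    into an allowed test function and keeps the weighted square nonnegative.\<close>
  define m :: "real \<Rightarrow> real" where "m t = (t - a) * (b - t)" for t
  have pm: "real_polynomial_function m"
    unfolding m_def by (intro real_polynomial_function.intros(4) real_polynomial_function_diff
      real_polynomial_function.intros(2) real_polynomial_function.intros(1)) auto
  have mpos: "t \<in> {a..b} \<Longrightarrow> m t \<ge> 0" for t by (simp add: m_def)
  have cm: "continuous_on {a..b} m" unfolding m_def by (intro continuous_intros)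
  note ci = integrable_continuous_real continuous_intros cm assms(2)
  define I where "I = integral {a..b} (\<lambda>t. m t * \<bar>f t\<bar>)"
  have "I \<ge> 0" unfolding I_def by (rule integral_nonneg) (auto intro!: ci simp: mpos)
  have bound: "integral {a..b} (\<lambda>t. m t * (f t)\<^sup>2) \<le> e * I" if e: "e > 0" for e
  proof -
    obtain g where g: "real_polynomial_function g" "\<And>x. x \<in> {a..b} \<Longrightarrow> \<bar>f x - g x\<bar> < e"
      using Stone_Weierstrass_real_polynomial_function[OF compact_Icc assms(2) e] by blast
    have cg: "continuous_on {a..b} g"
      using g(1) continuous_on_polymonial_function real_polynomial_function_eq by blast
    \<comment> \<open>One factor \<open>f\<close> is split into \<open>f - g\<close> and
      \<open>g\<close>. The part with \<open>g\<close> vanishes by orthogonality, and the rest is at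
      most \<open>e\<close> times the fixed number \<open>I\<close>.\<close>
    have "integral {a..b} (\<lambda>t. m t * (f t)\<^sup>2)
        = integral {a..b} (\<lambda>t. m t * f t * (f t - g t) + f t * (m t * g t))"
      by (intro integral_cong) (simp add: power2_eq_square algebra_simps)
    also have "\<dots> = integral {a..b} (\<lambda>t. m t * f t * (f t - g t))
        + integral {a..b} (\<lambda>t. f t * (m t * g t))"
      by (intro Henstock_Kurzweil_Integration.integral_add ci cg)
    also have "integral {a..b} (\<lambda>t. f t * (m t * g t)) = 0"
      by (rule orth) (use pm g(1) in \<open>auto simp: m_def[abs_def] intro: real_polynomial_function.intros(4)\<close>)
    also have "integral {a..b} (\<lambda>t. m t * f t * (f t - g t)) + 0
        \<le> integral {a..b} (\<lambda>t. e * (m t * \<bar>f t\<bar>))"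
    proof (simp only: add_0_right, rule integral_le)
      fix t assume t: "t \<in> {a..b}"
      have "m t * f t * (f t - g t) \<le> \<bar>m t * f t\<bar> * \<bar>f t - g t\<bar>"
        by (metis abs_ge_self abs_mult)
      also have "\<dots> \<le> \<bar>m t * f t\<bar> * e" using g(2)[OF t] by (intro mult_left_mono) auto
      finally show "m t * f t * (f t - g t) \<le> e * (m t * \<bar>f t\<bar>)"
        using mpos[OF t] by (simp add: abs_mult mult_ac)
    qed (intro ci cg)+
    also have "\<dots> = e * I" by (simp add: I_def)
    finally show ?thesis .
  qed
  have "integral {a..b} (\<lambda>t. m t * (f t)\<^sup>2) \<le> 0 + e" if "e > 0" for e
  proof -
    \<comment> \<open>\<open>I\<close> may be zero, hence the division by
      \<open>I + 1\<close>.\<close>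
    have "integral {a..b} (\<lambda>t. m t * (f t)\<^sup>2) \<le> e / (I + 1) * I"
      using \<open>I \<ge> 0\<close> that by (intro bound) auto
    also have "\<dots> \<le> e" using \<open>I \<ge> 0\<close> that by (simp add: field_simps)
    finally show ?thesis by simp
  qed
  then have "integral {a..b} (\<lambda>t. m t * (f t)\<^sup>2) \<le> 0" by (rule field_le_epsilon)
  moreover have "integral {a..b} (\<lambda>t. m t * (f t)\<^sup>2) \<ge> 0"
    by (rule integral_nonneg) (auto intro!: ci simp: mpos)
  ultimately have "\<forall>t\<in>{a..b}. m t * (f t)\<^sup>2 = 0"
    using \<open>a < b\<close> mpos by (subst integral_eq_0_iff[symmetric]) (auto intro!: ci)
  \<comment> \<open>The weight is nonzero only in the interior; continuity then carries the value
    zero to the endpoints.\<close>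
  then have "f t = 0" if "t \<in> {a<..<b}" for t
    using that by (force simp: m_def)
  then show ?thesis
    using continuous_constant_on_closure[of "{a<..<b}" f 0 t] assms by simp
qed

text \<open>The positive minimum of \<open>g\<close> over the slice s = 0 bounds how far
  \<open>g\<close> may drop, and uniform continuity makes the permitted range of s independent of
  t.\<close>

lemma positive_near_compact_slice:
  fixes g :: "real \<times> real \<Rightarrow> real"
  assumes "a \<le> b" "continuous_on (UNIV \<times> {a..b}) g" "\<And>t. t \<in> {a..b} \<Longrightarrow> g (0, t) > 0"
  obtains \<delta> where "\<delta> > 0" "\<And>s t. \<bar>s\<bar> < \<delta> \<Longrightarrow> t \<in> {a..b} \<Longrightarrow> g (s, t) > 0"
proof -
  have "continuous_on {a..b} (\<lambda>t. g (0, t))"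
    by (rule continuous_on_compose2[OF assms(2)]) (auto intro!: continuous_intros)
  then obtain t0 where t0: "t0 \<in> {a..b}" "\<And>t. t \<in> {a..b} \<Longrightarrow> g (0, t0) \<le> g (0, t)"
    using continuous_attains_inf[of "{a..b}" "\<lambda>t. g (0, t)"] assms(1) by auto
  \<comment> \<open>Any compact strip around the slice would do; its half-width 1 reappears in
    \<open>min d 1\<close>.\<close>
  have "uniformly_continuous_on ({-1..1} \<times> {a..b}) g"
    by (rule compact_uniformly_continuous)
       (auto intro!: compact_Times continuous_on_subset[OF assms(2)])
  then obtain d where d: "d > 0" "\<And>x y. x \<in> {-1..1} \<times> {a..b} \<Longrightarrow> y \<in> {-1..1} \<times> {a..b} \<Longrightarrow>
      dist y x < d \<Longrightarrow> dist (g y) (g x) < g (0, t0)"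
    unfolding uniformly_continuous_on_def using assms(3)[OF t0(1)] by metis
  show ?thesis
  proof (rule that[of "min d 1"])
    fix s t :: real assume st: "\<bar>s\<bar> < min d 1" "t \<in> {a..b}"
    then have "dist (g (s, t)) (g (0, t)) < g (0, t0)"
      by (intro d(2)) (auto simp: dist_Pair_Pair)
    then show "g (s, t) > 0" using t0(2)[OF st(2)] by (auto simp: dist_real_def)
  qed (use d in auto)
qed

section \<open>Curvature in the coordinates of the parametrization\<close>

definition height :: "real \<Rightarrow> real \<Rightarrow> real \<Rightarrow> real" where
  "height lam x y = cosh x * sin y - sinh x + lam"

text \<open>In the next definitions \<open>x\<close>, \<open>y\<close> stand for the coordinates \<open>u\<close>, \<open>v\<close> of a point, \<open>p\<close>,
  \<open>q\<close> for \<open>u'\<close>, \<open>v'\<close> and \<open>p2\<close>, \<open>q2\<close> for \<open>u''\<close>, \<open>v''\<close>.\<close>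

definition speed_sq :: "real \<Rightarrow> real \<Rightarrow> real \<Rightarrow> real \<Rightarrow> real" where
  "speed_sq eps x p q = eps * (q\<^sup>2 * (cosh x)\<^sup>2 - p\<^sup>2)"

definition speed_sq_deriv :: "real \<Rightarrow> real \<Rightarrow> real \<Rightarrow> real \<Rightarrow> real \<Rightarrow> real \<Rightarrow> real" where
  "speed_sq_deriv eps x p q p2 q2 =
     eps * (2 * q * q2 * (cosh x)\<^sup>2 + 2 * q\<^sup>2 * cosh x * sinh x * p - 2 * p * p2)"

text \<open>The determinant of position, velocity and acceleration of the curve. The coordinate
  \<open>y\<close> is absent because rotations about the z-axis preserve this determinant.\<close>

definition Psi_det :: "real \<Rightarrow> real \<Rightarrow> real \<Rightarrow> real \<Rightarrow> real \<Rightarrow> real" where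
  "Psi_det x p q p2 q2 =
     cosh x * q * (p2 + q\<^sup>2 * cosh x * sinh x) - cosh x * p * q2 - 2 * p\<^sup>2 * q * sinh x"

definition curv_rhs :: "real \<Rightarrow> real \<Rightarrow> real \<Rightarrow> real \<Rightarrow> real \<Rightarrow> real \<Rightarrow> real" where
  "curv_rhs lam eps x y p q =
     - (q * cosh x * (sinh x * sin y - cosh x) + p * cos y)
       / (height lam x y * sqrt (speed_sq eps x p q))"

lemma lorentz_cderiv_Psi:
  assumes "a < b" "t \<in> {a..b}"
    and "(u has_real_derivative p) (at t within {a..b})"
    and "(v has_real_derivative q) (at t within {a..b})"
  shows "lorentz (cderiv a b (\<lambda>t. Psi (u t) (v t)) t) (cderiv a b (\<lambda>t. Psi (u t) (v t)) t) =
    q\<^sup>2 * (cosh (u t))\<^sup>2 - p\<^sup>2"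
proof -
  have "(cosh (u t))\<^sup>2 = (sinh (u t))\<^sup>2 + 1" "(sin (v t))\<^sup>2 + (cos (v t))\<^sup>2 = 1"
    by (simp_all add: cosh_square_eq)
  then show ?thesis
    unfolding cderiv_Psi[OF assms] lorentz_def vector_3 by algebra
qed

lemma speed_Psi:
  assumes "a < b" "t \<in> {a..b}"
    and "(u has_real_derivative p) (at t within {a..b})"
    and "(v has_real_derivative q) (at t within {a..b})"
  shows "speed a b eps (\<lambda>t. Psi (u t) (v t)) t = sqrt (speed_sq eps (u t) p q)"
  unfolding speed_def speed_sq_def lorentz_cderiv_Psi[OF assms] ..

text \<open>The sign \<open>eps\<close> turns the spacelike and the timelike condition into one
  strict inequality, so that both cases are treated together from here on.\<close>

lemma nondegenerate_iff_speed_sq: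
  assumes "a < b" "\<bar>eps\<bar> = 1" "smooth1 a b u" "smooth1 a b v"
  shows "nondegenerate a b eps (\<lambda>t. Psi (u t) (v t)) \<longleftrightarrow>
    (\<forall>t\<in>{a..b}. speed_sq eps (u t) (cderiv a b u t) (cderiv a b v t) > 0)"
proof -
  have "eps = 1 \<or> eps = -1" using assms(2) by linarith
  then show ?thesis
    using lorentz_cderiv_Psi[OF assms(1) _ smooth1_DERIV[OF assms(1,3)] smooth1_DERIV[OF assms(1,4)]]
    by (auto simp: nondegenerate_def spacelike_def timelike_def speed_sq_def)
qed

lemma nondegenerate_sign: "nondegenerate a b eps \<gamma> \<Longrightarrow> \<bar>eps\<bar> = 1"
  by (auto simp: nondegenerate_def)

lemma has_vector_derivative_vector_3:
  assumes "(f has_real_derivative f') (at t within S)"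
    "(g has_real_derivative g') (at t within S)"
    "(h has_real_derivative h') (at t within S)"
  shows "((\<lambda>t. vector [f t, g t, h t] :: real^3) has_vector_derivative vector [f', g', h'])
    (at t within S)"
proof -
  have e: "(vector [x, y, z] :: real^3) = x *\<^sub>R axis 1 1 + y *\<^sub>R axis 2 1 + z *\<^sub>R axis 3 1" for x y z
    by (simp add: vec_eq_iff forall_3 axis_def)
  show ?thesis
    unfolding e by (rule derivative_eq_intros assms refl | simp)+
qed

lemma curvature_Psi:
  assumes "a < b" "t \<in> {a..b}" "smooth1 a b u" "smooth1 a b v"
  defines "u1 \<equiv> cderiv a b u" and "v1 \<equiv> cderiv a b v"
  shows "curvature a b eps (\<lambda>t. Psi (u t) (v t)) t =
    eps * Psi_det (u t) (u1 t) (v1 t) (cderiv a b u1 t) (cderiv a b v1 t)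
      / sqrt (speed_sq eps (u t) (u1 t) (v1 t)) ^ 3"
proof -
  have du: "(u has_real_derivative u1 t) (at t within {a..b})"
    and dv: "(v has_real_derivative v1 t) (at t within {a..b})" if "t \<in> {a..b}" for t
    unfolding u1_def v1_def using assms that smooth1_DERIV by auto
  have du1: "(u1 has_real_derivative cderiv a b u1 t) (at t within {a..b})"
    and dv1: "(v1 has_real_derivative cderiv a b v1 t) (at t within {a..b})"
    unfolding u1_def v1_def using assms smooth1_DERIV smooth1_cderiv by auto
  define p q p2 q2 where defs: "p = u1 t" "q = v1 t" "p2 = cderiv a b u1 t" "q2 = cderiv a b v1 t"
  define C S c s where Cs: "C = cosh (u t)" "S = sinh (u t)" "c = cos (v t)" "s = sin (v t)"
  define W :: "real \<Rightarrow> real^3" where "W t = vector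
      [sinh (u t) * u1 t * cos (v t) - cosh (u t) * sin (v t) * v1 t,
       sinh (u t) * u1 t * sin (v t) + cosh (u t) * cos (v t) * v1 t,
       cosh (u t) * u1 t]" for t
  define W' :: "real^3" where "W' = vector
      [(C * p * p + S * p2) * c - S * p * s * q - (S * p * s * q + C * c * q * q + C * s * q2),
       (C * p * p + S * p2) * s + S * p * c * q + (S * p * c * q - C * s * q * q + C * c * q2),
       S * p * p + C * p2]"
  have 1: "cderiv a b (\<lambda>t. Psi (u t) (v t)) t = W t" if "t \<in> {a..b}" for t
    unfolding W_def using cderiv_Psi[OF assms(1) that du[OF that] dv[OF that]] .
  have "(W has_vector_derivative W') (at t within {a..b})"
    unfolding W_def[abs_def] W'_def
    by (rule has_vector_derivative_vector_3;
        (rule derivative_eq_intros du[OF assms(2)] dv[OF assms(2)] du1 dv1 refl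
         | simp add: defs Cs algebra_simps)+)
  then have "cderiv a b W t = W'" using assms(1,2) cderiv_eq by blast
  \<comment> \<open>\<open>W\<close> is known to be the velocity only on the interval, which
    suffices because \<open>cderiv\<close> depends on nothing else.\<close>
  then have 2: "cderiv a b (cderiv a b (\<lambda>t. Psi (u t) (v t))) t = W'"
    using cderiv_cong[OF assms(2), of "cderiv a b (\<lambda>t. Psi (u t) (v t))" W] 1 by simp
  \<comment> \<open>The cofactor expansion of the determinant along the position row is a
    polynomial, reduced modulo these two identities.\<close>
  have "C\<^sup>2 = S\<^sup>2 + 1" "s\<^sup>2 + c\<^sup>2 = 1" by (simp_all add: Cs cosh_square_eq)
  then have "(C * c) * (((S * p * s + C * c * q) * (S * p * p + C * p2)
        - (C * p) * ((C * p * p + S * p2) * s + S * p * c * q + (S * p * c * q - C * s * q * q + C * c * q2))))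
      - (C * s) * ((S * p * c - C * s * q) * (S * p * p + C * p2)
        - (C * p) * ((C * p * p + S * p2) * c - S * p * s * q - (S * p * s * q + C * c * q * q + C * s * q2)))
      + S * ((S * p * c - C * s * q) * ((C * p * p + S * p2) * s + S * p * c * q + (S * p * c * q - C * s * q * q + C * c * q2))
        - (S * p * s + C * c * q) * ((C * p * p + S * p2) * c - S * p * s * q - (S * p * s * q + C * c * q * q + C * s * q2)))
      = C * q * (p2 + q\<^sup>2 * C * S) - C * p * q2 - 2 * p\<^sup>2 * q * S"
    by algebra
  then have "det (vector [Psi (u t) (v t), W t, W'] :: real^3^3) = Psi_det (u t) p q p2 q2"
    unfolding det_3 vector_3 Psi_def W_def W'_def Psi_det_def Cs[symmetric] defs(1,2)[symmetric]
    by (simp only: algebra_simps)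
  then show ?thesis
    unfolding curvature_det 2 1[OF assms(2)] defs
    by (subst speed_Psi[OF assms(1,2) du[OF assms(2)] dv[OF assms(2)]]) simp
qed

section \<open>The Euler-Lagrange expressions\<close>

text \<open>For the integrand \<open>height * sqrt speed_sq\<close> this is its x derivative minus
  the total t derivative of its p derivative, with the latter carried out along the curve;
  \<open>EL_v\<close> is the same with y and q.\<close>

definition EL_u :: "real \<Rightarrow> real \<Rightarrow> real \<Rightarrow> real \<Rightarrow> real \<Rightarrow> real \<Rightarrow> real \<Rightarrow> real \<Rightarrow> real" where
  "EL_u lam eps x y p q p2 q2 =
     (let h = height lam x y; h' = (sinh x * sin y - cosh x) * p + cosh x * cos y * q;
          w = speed_sq eps x p q; w' = speed_sq_deriv eps x p q p2 q2
      in (sinh x * sin y - cosh x) * sqrt w + eps * h * q\<^sup>2 * cosh x * sinh x / sqrt w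
         + eps * ((h' * p + h * p2) / sqrt w - h * p * w' / (2 * sqrt w ^ 3)))"

definition EL_v :: "real \<Rightarrow> real \<Rightarrow> real \<Rightarrow> real \<Rightarrow> real \<Rightarrow> real \<Rightarrow> real \<Rightarrow> real \<Rightarrow> real" where
  "EL_v lam eps x y p q p2 q2 =
     (let h = height lam x y; h' = (sinh x * sin y - cosh x) * p + cosh x * cos y * q;
          w = speed_sq eps x p q; w' = speed_sq_deriv eps x p q p2 q2
      in cosh x * cos y * sqrt w
         - eps * ((h' * q * (cosh x)\<^sup>2 + h * q2 * (cosh x)\<^sup>2 + 2 * h * q * cosh x * sinh x * p) / sqrt w
                  - h * q * (cosh x)\<^sup>2 * w' / (2 * sqrt w ^ 3)))"

text \<open>Multiplication by the cube of the speed \<open>r\<close> clears all denominators; what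
  remains are polynomial identities modulo the formula for the square of \<open>r\<close> and
  \<open>eps\<^sup>2 = 1\<close>.\<close>

lemma EL_eq_curvature_defect:
  fixes p2 q2 :: real
  assumes eps: "\<bar>eps\<bar> = 1" and h: "height lam x y \<noteq> 0" and w: "speed_sq eps x p q > 0"
  defines "K \<equiv> eps * cosh x * height lam x y *
    (eps * Psi_det x p q p2 q2 / sqrt (speed_sq eps x p q) ^ 3 - curv_rhs lam eps x y p q)"
  shows "EL_u lam eps x y p q p2 q2 = K * q" "EL_v lam eps x y p q p2 q2 = - K * p"
proof -
  define r where "r = sqrt (speed_sq eps x p q)"
  define C S c s H where Cs: "C = cosh x" "S = sinh x" "c = cos y" "s = sin y" "H = height lam x y"
  have r: "r > 0" and r2: "r\<^sup>2 = eps * (q\<^sup>2 * C\<^sup>2 - p\<^sup>2)"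
    using w by (simp_all add: r_def speed_sq_def Cs)
  have e2: "eps\<^sup>2 = 1" using eps by (metis abs_1 abs_eq_iff power2_eq_iff power_one)
  define w' where "w' = eps * (2 * q * q2 * C\<^sup>2 + 2 * q\<^sup>2 * C * S * p - 2 * p * p2)"
  define D where "D = C * q * (p2 + q\<^sup>2 * C * S) - C * p * q2 - 2 * p\<^sup>2 * q * S"
  define N where "N = q * C * (S * s - C) + p * c"
  have w2: "eps * w' = 2 * (q * q2 * C\<^sup>2 + q\<^sup>2 * C * S * p - p * p2)"
    unfolding w'_def using e2 by algebra
  \<comment> \<open>\<open>D\<close> is the determinant in the curvature, and \<open>- N\<close> is
    the numerator of the claimed curvature.\<close>
  have K: "K * r ^ 3 = C * H * D + eps * C * N * r\<^sup>2"
  proof -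
    have "K = eps * C * H * (eps * D / r ^ 3 + N / (H * r))"
      unfolding K_def Psi_det_def curv_rhs_def r_def[symmetric] Cs[symmetric] D_def N_def
      by (simp only: minus_divide_left[symmetric] diff_minus_eq_add)
    also have "\<dots> * r ^ 3 = eps * eps * C * H * D + eps * C * N * r\<^sup>2"
      using r h by (simp add: field_simps power2_eq_square power3_eq_cube Cs)
    finally show ?thesis using e2 by (simp add: power2_eq_square)
  qed
  define U where "U = ((S * s - C) * r + eps * H * q\<^sup>2 * C * S / r
    + eps * ((((S * s - C) * p + C * c * q) * p + H * p2) / r - H * p * w' / (2 * r ^ 3)))"
  define V where "V = (C * c * r - eps * ((((S * s - C) * p + C * c * q) * q * C\<^sup>2
      + H * q2 * C\<^sup>2 + 2 * H * q * C * S * p) / r - H * q * C\<^sup>2 * w' / (2 * r ^ 3)))"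
  \<comment> \<open>After this multiplication only even powers of \<open>r\<close> occur, so
    \<open>r2\<close> eliminates \<open>r\<close> entirely.\<close>
  have "U * r ^ 3 = (S * s - C) * (r\<^sup>2)\<^sup>2 + eps * H * q\<^sup>2 * C * S * r\<^sup>2
      + eps * (((S * s - C) * p + C * c * q) * p + H * p2) * r\<^sup>2 - H * p * (eps * w') / 2"
    unfolding U_def using r by (simp add: field_simps power2_eq_square power3_eq_cube)
  also have "\<dots> = (C * H * D + eps * C * N * r\<^sup>2) * q"
    unfolding r2 w2 D_def N_def using e2 by (simp add: field_simps) algebra
  finally have "U * r ^ 3 = K * q * r ^ 3" using K by algebra
  then have "U = K * q" using r by simp
  then show "EL_u lam eps x y p q p2 q2 = K * q"
    unfolding EL_u_def Let_def speed_sq_deriv_def r_def[symmetric] Cs[symmetric] U_def w'_def .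
  have "V * r ^ 3 = C * c * (r\<^sup>2)\<^sup>2 - eps * (((S * s - C) * p + C * c * q) * q * C\<^sup>2
      + H * q2 * C\<^sup>2 + 2 * H * q * C * S * p) * r\<^sup>2 + H * q * C\<^sup>2 * (eps * w') / 2"
    unfolding V_def using r by (simp add: field_simps power2_eq_square power3_eq_cube)
  also have "\<dots> = - (C * H * D + eps * C * N * r\<^sup>2) * p"
    unfolding r2 w2 D_def N_def using e2 by (simp add: field_simps) algebra
  finally have "V * r ^ 3 = - K * p * r ^ 3" using K by algebra
  then have "V = - K * p" by (simp only: mult_cancel_right) (use r in simp)
  then show "EL_v lam eps x y p q p2 q2 = - K * p"
    unfolding EL_v_def Let_def speed_sq_deriv_def r_def[symmetric] Cs[symmetric] V_def w'_def .
qed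

section \<open>The first variation\<close>

lemma smooth2E:
  assumes "smooth2 S a b F"
  obtains D where "\<And>s t. s \<in> S \<Longrightarrow> t \<in> {a..b} \<Longrightarrow> D 0 0 s t = F s t"
    "\<And>i j. continuous_on (S \<times> {a..b}) (\<lambda>z. D i j (fst z) (snd z))"
    "\<And>i j s t. s \<in> S \<Longrightarrow> t \<in> {a..b} \<Longrightarrow>
      ((\<lambda>x. D i j x t) has_real_derivative D (Suc i) j s t) (at s within S)"
    "\<And>i j s t. s \<in> S \<Longrightarrow> t \<in> {a..b} \<Longrightarrow>
      ((\<lambda>y. D i j s y) has_real_derivative D i (Suc j) s t) (at t within {a..b})"
proof -
  obtain D where D: "\<forall>s\<in>S. \<forall>t\<in>{a..b}. D 0 0 s t = F s t"
    "\<forall>i j. continuous_on (S \<times> {a..b}) (\<lambda>(s, t). D i j s t) \<and>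
      (\<forall>s\<in>S. \<forall>t\<in>{a..b}.
        ((\<lambda>x. D i j x t) has_real_derivative D (Suc i) j s t) (at s within S) \<and>
        ((\<lambda>y. D i j s y) has_real_derivative D i (Suc j) s t) (at t within {a..b}))"
    using assms unfolding smooth2_def by (elim exE conjE)
  show ?thesis
    by (rule that[of D]) (use D in \<open>simp_all add: split_beta\<close>)
qed

lemma smooth2_cderiv:
  assumes "a < b" "\<And>s t. s \<in> S \<Longrightarrow> t \<in> {a..b} \<Longrightarrow> D 0 0 s t = F s t"
    and "\<And>j s t. s \<in> S \<Longrightarrow> t \<in> {a..b} \<Longrightarrow>
      ((\<lambda>y. D 0 j s y) has_real_derivative D 0 (Suc j) s t) (at t within {a..b})"
    and "s \<in> S" "t \<in> {a..b}"
  shows "cderiv a b (F s) t = D 0 1 s t"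
proof -
  have "cderiv a b (F s) t = cderiv a b (D 0 0 s) t"
    by (rule cderiv_cong) (use assms in auto)
  also have "\<dots> = D 0 1 s t"
    using assms(3)[OF assms(4,5), of 0] assms(1,5) cderiv_real_eq by simp
  finally show ?thesis .
qed

text \<open>Supplies the variation field of a family, which \<open>first_variation\<close> takes as
  given.\<close>

lemma smooth2_has_derivative_at_0:
  assumes "\<delta> > 0" "smooth2 {-\<delta><..<\<delta>} a b F"
  obtains \<eta> where "\<And>t. t \<in> {a..b} \<Longrightarrow> ((\<lambda>s. F s t) has_real_derivative \<eta> t) (at 0)"
proof -
  obtain D where D: "\<And>s t. s \<in> {-\<delta><..<\<delta>} \<Longrightarrow> t \<in> {a..b} \<Longrightarrow> D 0 0 s t = F s t"
    "\<And>i j s t. s \<in> {-\<delta><..<\<delta>} \<Longrightarrow> t \<in> {a..b} \<Longrightarrow>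
      ((\<lambda>x. D i j x t) has_real_derivative D (Suc i) j s t) (at s within {-\<delta><..<\<delta>})"
    using assms(2) by (rule smooth2E) (rule that)
  have "((\<lambda>s. F s t) has_real_derivative D 1 0 0 t) (at 0)" if t: "t \<in> {a..b}" for t
  proof -
    have "((\<lambda>s. D 0 0 s t) has_real_derivative D (Suc 0) 0 0 t) (at 0 within {-\<delta><..<\<delta>})"
      using D(2) t assms(1) by auto
    then have "((\<lambda>s. D 0 0 s t) has_real_derivative D 1 0 0 t) (at 0)"
      using assms(1) at_within_open[of 0 "{-\<delta><..<\<delta>}"] by simp
    then show ?thesis
      by (rule has_field_derivative_transform_within_open[where S = "{-\<delta><..<\<delta>}"])
         (use D(1) t assms(1) in auto)
  qed
  then show ?thesis by (rule that)
qed

text \<open>Chain rule in the parameter of a family at a fixed time: \<open>P\<close> and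
  \<open>Q\<close> are the velocities as functions of that parameter. Positivity makes the square
  root differentiable.\<close>

lemma energy_integrand_DERIV:
  fixes X Y P Q :: "real \<Rightarrow> real"
  assumes "(X has_real_derivative x') (at s within S)" "(Y has_real_derivative y') (at s within S)"
    "(P has_real_derivative p') (at s within S)" "(Q has_real_derivative q') (at s within S)"
    and "speed_sq eps (X s) (P s) (Q s) > 0"
  shows "((\<lambda>s. height lam (X s) (Y s) * sqrt (speed_sq eps (X s) (P s) (Q s))) has_real_derivative
    ((sinh (X s) * sin (Y s) - cosh (X s)) * x' + cosh (X s) * cos (Y s) * y')
        * sqrt (speed_sq eps (X s) (P s) (Q s))
    + height lam (X s) (Y s) * (eps * (2 * Q s * q' * (cosh (X s))\<^sup>2
        + 2 * (Q s)\<^sup>2 * cosh (X s) * sinh (X s) * x' - 2 * P s * p'))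
      / (2 * sqrt (speed_sq eps (X s) (P s) (Q s)))) (at s within S)"
proof -
  have "((\<lambda>s. height lam (X s) (Y s)) has_real_derivative
      (sinh (X s) * sin (Y s) - cosh (X s)) * x' + cosh (X s) * cos (Y s) * y') (at s within S)"
    unfolding height_def by (rule derivative_eq_intros assms refl | simp add: algebra_simps)+
  moreover have "((\<lambda>s. speed_sq eps (X s) (P s) (Q s)) has_real_derivative
      eps * (2 * Q s * q' * (cosh (X s))\<^sup>2
        + 2 * (Q s)\<^sup>2 * cosh (X s) * sinh (X s) * x' - 2 * P s * p')) (at s within S)"
    unfolding speed_sq_def by (rule derivative_eq_intros assms refl | simp add: algebra_simps)+
  ultimately show ?thesis
    using assms(5) by (auto intro!: derivative_eq_intros simp: field_simps)
qed

text \<open>The derivative of the integrand differs from the pairing with the Euler-Lagrange expressions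
  by the derivative of the boundary term of the integration by parts.\<close>

lemma boundary_term_DERIV:
  fixes u v p q f g :: "real \<Rightarrow> real"
  assumes "(u has_real_derivative p t) (at t within S)" "(v has_real_derivative q t) (at t within S)"
    "(p has_real_derivative p2) (at t within S)" "(q has_real_derivative q2) (at t within S)"
    "(f has_real_derivative f') (at t within S)" "(g has_real_derivative g') (at t within S)"
    and w: "speed_sq eps (u t) (p t) (q t) > 0"
  shows "((\<lambda>t. eps * height lam (u t) (v t) * (q t * (cosh (u t))\<^sup>2 * g t - p t * f t)
        / sqrt (speed_sq eps (u t) (p t) (q t))) has_real_derivative
    ((sinh (u t) * sin (v t) - cosh (u t)) * f t + cosh (u t) * cos (v t) * g t)
        * sqrt (speed_sq eps (u t) (p t) (q t))
    + height lam (u t) (v t) * (eps * (2 * q t * g' * (cosh (u t))\<^sup>2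
        + 2 * (q t)\<^sup>2 * cosh (u t) * sinh (u t) * f t - 2 * p t * f'))
      / (2 * sqrt (speed_sq eps (u t) (p t) (q t)))
    - (EL_u lam eps (u t) (v t) (p t) (q t) p2 q2 * f t
       + EL_v lam eps (u t) (v t) (p t) (q t) p2 q2 * g t)) (at t within S)"
proof -
  define h r where "h t = height lam (u t) (v t)" and "r t = sqrt (speed_sq eps (u t) (p t) (q t))" for t
  define C Sn c s where Cs: "C = cosh (u t)" "Sn = sinh (u t)" "c = cos (v t)" "s = sin (v t)"
  define w' where "w' = speed_sq_deriv eps (u t) (p t) (q t) p2 q2"
  define h' where "h' = (Sn * s - C) * p t + C * c * q t"
  have r: "r t > 0" using w by (simp add: r_def)
  have dh: "(h has_real_derivative h') (at t within S)"
    unfolding h_def[abs_def] height_def h'_def Cs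
    by (rule derivative_eq_intros assms refl | simp add: algebra_simps)+
  have "((\<lambda>t. speed_sq eps (u t) (p t) (q t)) has_real_derivative w') (at t within S)"
    unfolding w'_def speed_sq_deriv_def speed_sq_def
    by (rule derivative_eq_intros assms refl | simp add: algebra_simps)+
  then have dr: "(r has_real_derivative w' / (2 * r t)) (at t within S)"
    unfolding r_def[abs_def] using w by (auto intro!: derivative_eq_intros simp: field_simps)
  \<comment> \<open>The boundary term is \<open>f\<close> times the p derivative of the integrand
    plus \<open>g\<close> times its q derivative; this is the factor of it that contains
    \<open>f\<close> and \<open>g\<close>.\<close>
  have dA: "((\<lambda>t. q t * (cosh (u t))\<^sup>2 * g t - p t * f t) has_real_derivative
      q2 * C\<^sup>2 * g t + 2 * q t * C * Sn * p t * g t + q t * C\<^sup>2 * g' - p2 * f t - p t * f')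
      (at t within S)"
    unfolding Cs by (rule derivative_eq_intros assms refl | simp add: algebra_simps)+
  define A' where "A' = q2 * C\<^sup>2 * g t + 2 * q t * C * Sn * p t * g t + q t * C\<^sup>2 * g' - p2 * f t - p t * f'"
  have "((\<lambda>t. eps * h t * (q t * (cosh (u t))\<^sup>2 * g t - p t * f t)) has_real_derivative
      eps * h' * (q t * C\<^sup>2 * g t - p t * f t) + A' * (eps * h t)) (at t within S)"
    using DERIV_mult[OF DERIV_cmult[OF dh, of eps] dA] by (simp add: A'_def Cs)
  from DERIV_divide[OF this dr]
  have "((\<lambda>t. eps * h t * (q t * (cosh (u t))\<^sup>2 * g t - p t * f t) / r t) has_real_derivative
      ((eps * h' * (q t * C\<^sup>2 * g t - p t * f t) + A' * (eps * h t)) * r t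
        - eps * h t * (q t * C\<^sup>2 * g t - p t * f t) * (w' / (2 * r t))) / (r t * r t)) (at t within S)"
    (is "(_ has_real_derivative ?d) _")
    using r by (simp add: Cs)
  \<comment> \<open>Here \<open>h'\<close>, \<open>w'\<close> and \<open>r t\<close> stay opaque:
    once the powers of \<open>r t\<close> are cleared, both sides agree as polynomials in these
    letters.\<close>
  also have "?d = ((Sn * s - C) * f t + C * c * g t) * r t
    + h t * (eps * (2 * q t * g' * C\<^sup>2 + 2 * (q t)\<^sup>2 * C * Sn * f t - 2 * p t * f')) / (2 * r t)
    - (((Sn * s - C) * r t + eps * h t * (q t)\<^sup>2 * C * Sn / r t
         + eps * ((h' * p t + h t * p2) / r t - h t * p t * w' / (2 * r t ^ 3))) * f t
       + (C * c * r t - eps * ((h' * q t * C\<^sup>2 + h t * q2 * C\<^sup>2 + 2 * h t * q t * C * Sn * p t) / r t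
                  - h t * q t * C\<^sup>2 * w' / (2 * r t ^ 3))) * g t)"
    unfolding A'_def using r by (simp add: field_simps power3_eq_cube)
  finally show ?thesis
    unfolding EL_u_def EL_v_def Let_def h'_def w'_def h_def r_def Cs .
qed

text \<open>Differentiation under the integral sign, followed by integration by parts; the boundary
  term drops out because the endpoints are fixed.\<close>

lemma first_variation:
  assumes ab: "a < b" and su: "smooth1 a b u" and sv: "smooth1 a b v"
    and var: "variation a b eps u v \<delta> U V"
    and \<eta>: "\<And>t. t \<in> {a..b} \<Longrightarrow> ((\<lambda>s. U s t) has_real_derivative \<eta> t) (at 0)"
    and \<zeta>: "\<And>t. t \<in> {a..b} \<Longrightarrow> ((\<lambda>s. V s t) has_real_derivative \<zeta> t) (at 0)"
  defines "u1 \<equiv> cderiv a b u" and "v1 \<equiv> cderiv a b v"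
  shows "((\<lambda>s. energy lam a b eps (U s) (V s)) has_real_derivative
    integral {a..b} (\<lambda>t.
      EL_u lam eps (u t) (v t) (u1 t) (v1 t) (cderiv a b u1 t) (cderiv a b v1 t) * \<eta> t
    + EL_v lam eps (u t) (v t) (u1 t) (v1 t) (cderiv a b u1 t) (cderiv a b v1 t) * \<zeta> t)) (at 0)"
proof -
  define S where "S = {-\<delta><..<\<delta>}"
  have \<delta>: "\<delta> > 0" and S0: "0 \<in> S" and opS: "open S" and cvS: "convex S"
    using var unfolding variation_def S_def by auto
  have UV: "smooth2 S a b U" "smooth2 S a b V"
    and init: "\<And>t. t \<in> {a..b} \<Longrightarrow> U 0 t = u t" "\<And>t. t \<in> {a..b} \<Longrightarrow> V 0 t = v t"
    and ends: "\<And>s. s \<in> S \<Longrightarrow> U s a = u a" "\<And>s. s \<in> S \<Longrightarrow> V s a = v a"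
      "\<And>s. s \<in> S \<Longrightarrow> U s b = u b" "\<And>s. s \<in> S \<Longrightarrow> V s b = v b"
    and adm: "\<And>s. s \<in> S \<Longrightarrow> admissible a b eps (U s) (V s)"
    using var unfolding variation_def S_def by auto
  obtain X where X: "\<And>s t. s \<in> S \<Longrightarrow> t \<in> {a..b} \<Longrightarrow> X 0 0 s t = U s t"
      "\<And>i j. continuous_on (S \<times> {a..b}) (\<lambda>z. X i j (fst z) (snd z))"
      "\<And>i j s t. s \<in> S \<Longrightarrow> t \<in> {a..b} \<Longrightarrow>
        ((\<lambda>x. X i j x t) has_real_derivative X (Suc i) j s t) (at s within S)"
      "\<And>i j s t. s \<in> S \<Longrightarrow> t \<in> {a..b} \<Longrightarrow>
        ((\<lambda>y. X i j s y) has_real_derivative X i (Suc j) s t) (at t within {a..b})"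
    using UV(1) by (rule smooth2E) (rule that)
  obtain Y where Y: "\<And>s t. s \<in> S \<Longrightarrow> t \<in> {a..b} \<Longrightarrow> Y 0 0 s t = V s t"
      "\<And>i j. continuous_on (S \<times> {a..b}) (\<lambda>z. Y i j (fst z) (snd z))"
      "\<And>i j s t. s \<in> S \<Longrightarrow> t \<in> {a..b} \<Longrightarrow>
        ((\<lambda>x. Y i j x t) has_real_derivative Y (Suc i) j s t) (at s within S)"
      "\<And>i j s t. s \<in> S \<Longrightarrow> t \<in> {a..b} \<Longrightarrow>
        ((\<lambda>y. Y i j s y) has_real_derivative Y i (Suc j) s t) (at t within {a..b})"
    using UV(2) by (rule smooth2E) (rule that)
  have dX: "cderiv a b (U s) t = X 0 1 s t" and dY: "cderiv a b (V s) t = Y 0 1 s t"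
    if "s \<in> S" "t \<in> {a..b}" for s t
    using smooth2_cderiv[where D = X and F = U, OF ab X(1) X(4) that]
      smooth2_cderiv[where D = Y and F = V, OF ab Y(1) Y(4) that] by blast+
  have eps: "\<bar>eps\<bar> = 1"
    using adm[OF S0] nondegenerate_sign unfolding admissible_def by blast
  have w: "speed_sq eps (X 0 0 s t) (X 0 1 s t) (Y 0 1 s t) > 0" if "s \<in> S" "t \<in> {a..b}" for s t
    using adm[OF that(1)] nondegenerate_iff_speed_sq[OF ab eps, of "U s" "V s"] that
    by (simp add: admissible_def dX dY X(1))
  \<comment> \<open>\<open>f\<close> is the energy integrand of the family and \<open>fs\<close> its
    s derivative. Both are written in the partial derivatives \<open>X i j\<close> and
    \<open>Y i j\<close>, whose joint continuity justifies differentiating under the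
    integral.\<close>
  define f where "f s t = height lam (X 0 0 s t) (Y 0 0 s t)
      * sqrt (speed_sq eps (X 0 0 s t) (X 0 1 s t) (Y 0 1 s t))" for s t
  define fs where "fs s t =
      ((sinh (X 0 0 s t) * sin (Y 0 0 s t) - cosh (X 0 0 s t)) * X 1 0 s t
        + cosh (X 0 0 s t) * cos (Y 0 0 s t) * Y 1 0 s t)
        * sqrt (speed_sq eps (X 0 0 s t) (X 0 1 s t) (Y 0 1 s t))
    + height lam (X 0 0 s t) (Y 0 0 s t) * (eps * (2 * Y 0 1 s t * Y 1 1 s t * (cosh (X 0 0 s t))\<^sup>2
        + 2 * (Y 0 1 s t)\<^sup>2 * cosh (X 0 0 s t) * sinh (X 0 0 s t) * X 1 0 s t
        - 2 * X 0 1 s t * X 1 1 s t))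
      / (2 * sqrt (speed_sq eps (X 0 0 s t) (X 0 1 s t) (Y 0 1 s t)))" for s t
  have energy: "energy lam a b eps (U s) (V s) = integral {a..b} (f s)" if "s \<in> S" for s
    unfolding energy_def f_def height_def speed_sq_def
    by (rule integral_cong) (use that dX dY X(1) Y(1) in auto)
  note cont = X(2) Y(2)
  have contw: "continuous_on (S \<times> {a..b}) (\<lambda>z. speed_sq eps (X 0 0 (fst z) (snd z)) (X 0 1 (fst z) (snd z)) (Y 0 1 (fst z) (snd z)))"
    unfolding speed_sq_def by (intro continuous_intros cont)
  have conth: "continuous_on (S \<times> {a..b}) (\<lambda>z. height lam (X 0 0 (fst z) (snd z)) (Y 0 0 (fst z) (snd z)))"
    unfolding height_def by (intro continuous_intros cont)
  have contf: "continuous_on (S \<times> {a..b}) (\<lambda>z. f (fst z) (snd z))"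
    unfolding f_def by (intro continuous_intros contw conth)
  have contfs: "continuous_on (S \<times> {a..b}) (\<lambda>z. fs (fst z) (snd z))"
    unfolding fs_def by (intro continuous_intros cont contw conth) (use w in force)
  have slice: "continuous_on {a..b} (g s)"
    if "continuous_on (S \<times> {a..b}) (\<lambda>z. g (fst z) (snd z))" "s \<in> S" for g :: "real \<Rightarrow> real \<Rightarrow> real" and s
  proof -
    have "continuous_on {a..b} (\<lambda>t. (\<lambda>z. g (fst z) (snd z)) (s, t))"
      by (rule continuous_on_compose2[OF that(1)]) (auto intro!: continuous_intros that)
    then show ?thesis by simp
  qed
  have "((\<lambda>s. integral (cbox a b) (f s)) has_field_derivative integral (cbox a b) (fs 0)) (at 0 within S)"
  proof (rule leibniz_rule_field_derivative[OF _ _ _ S0 cvS])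
    fix s t assume "s \<in> S" "t \<in> cbox a b"
    then show "((\<lambda>s. f s t) has_real_derivative fs s t) (at s within S)"
      unfolding f_def fs_def
      using X(3)[of s t 0 0] X(3)[of s t 0 1] Y(3)[of s t 0 0] Y(3)[of s t 0 1] w
      by (intro energy_integrand_DERIV) auto
  next
    fix s assume "s \<in> S"
    then show "f s integrable_on cbox a b"
      using slice[OF contf] by (auto intro: integrable_continuous_real)
  next
    show "continuous_on (S \<times> cbox a b) (\<lambda>(s, t). fs s t)"
      using contfs by (simp add: split_beta)
  qed
  then have "((\<lambda>s. integral {a..b} (f s)) has_real_derivative integral {a..b} (fs 0)) (at 0)"
    using at_within_open[OF S0 opS] by simp
  then have E: "((\<lambda>s. energy lam a b eps (U s) (V s)) has_real_derivative integral {a..b} (fs 0)) (at 0)"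
    by (rule has_field_derivative_transform_within_open[OF _ opS S0]) (simp add: energy)
  \<comment> \<open>The s derivative from the smoothness witness is the given variation field, by
    uniqueness of derivatives.\<close>
  have \<eta>X: "X 1 0 0 t = \<eta> t" and \<zeta>Y: "Y 1 0 0 t = \<zeta> t" if t: "t \<in> {a..b}" for t
  proof -
    have "((\<lambda>s. X 0 0 s t) has_real_derivative X 1 0 0 t) (at 0)"
      using X(3)[OF S0 t, of 0 0] at_within_open[OF S0 opS] by simp
    then have "((\<lambda>s. U s t) has_real_derivative X 1 0 0 t) (at 0)"
      by (rule has_field_derivative_transform_within_open[OF _ opS S0]) (rule X(1)[OF _ t])
    then show "X 1 0 0 t = \<eta> t" using \<eta>[OF t] by (rule DERIV_unique)
    have "((\<lambda>s. Y 0 0 s t) has_real_derivative Y 1 0 0 t) (at 0)"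
      using Y(3)[OF S0 t, of 0 0] at_within_open[OF S0 opS] by simp
    then have "((\<lambda>s. V s t) has_real_derivative Y 1 0 0 t) (at 0)"
      by (rule has_field_derivative_transform_within_open[OF _ opS S0]) (rule Y(1)[OF _ t])
    then show "Y 1 0 0 t = \<zeta> t" using \<zeta>[OF t] by (rule DERIV_unique)
  qed
  \<comment> \<open>Applied at the endpoints, where the family is constant in s, so that the
    variation field vanishes there.\<close>
  have const: "d = 0" if "\<And>s. s \<in> S \<Longrightarrow> g s = c" "(g has_real_derivative d) (at 0)"
    for g :: "real \<Rightarrow> real" and c d
  proof -
    have "((\<lambda>s. c) has_real_derivative d) (at 0)"
      by (rule has_field_derivative_transform_within_open[OF that(2) opS S0]) (simp add: that(1))
    then show ?thesis using DERIV_const DERIV_unique by blast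
  qed
  have e0: "X 1 0 0 a = 0" "X 1 0 0 b = 0" "Y 1 0 0 a = 0" "Y 1 0 0 b = 0"
    using const[OF ends(1) \<eta>[of a]] const[OF ends(3) \<eta>[of b]]
      const[OF ends(2) \<zeta>[of a]] const[OF ends(4) \<zeta>[of b]] \<eta>X \<zeta>Y ab by auto
  have 0: "X 0 0 0 t = u t" "Y 0 0 0 t = v t" if "t \<in> {a..b}" for t
    using X(1) Y(1) init that S0 by auto
  have 1: "X 0 1 0 t = u1 t" "Y 0 1 0 t = v1 t" if t: "t \<in> {a..b}" for t
    using dX[OF S0 t] dY[OF S0 t] cderiv_cong[OF t, of "U 0" u] cderiv_cong[OF t, of "V 0" v] init
    by (simp_all add: u1_def v1_def)
  have 2: "X 0 (Suc 1) 0 t = cderiv a b u1 t" "Y 0 (Suc 1) 0 t = cderiv a b v1 t" if t: "t \<in> {a..b}" for t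
    using cderiv_real_eq[OF ab t X(4)[OF S0 t, of 0 1]] cderiv_real_eq[OF ab t Y(4)[OF S0 t, of 0 1]]
      cderiv_cong[OF t, of "X 0 1 0" u1] cderiv_cong[OF t, of "Y 0 1 0" v1] 1 by simp_all
  \<comment> \<open>The boundary term of the integration by parts; it is zero at \<open>a\<close>
    and \<open>b\<close> by \<open>e0\<close>.\<close>
  define B where "B t = eps * height lam (X 0 0 0 t) (Y 0 0 0 t)
      * (Y 0 1 0 t * (cosh (X 0 0 0 t))\<^sup>2 * Y 1 0 0 t - X 0 1 0 t * X 1 0 0 t)
      / sqrt (speed_sq eps (X 0 0 0 t) (X 0 1 0 t) (Y 0 1 0 t))" for t
  define L where "L t =
      EL_u lam eps (u t) (v t) (u1 t) (v1 t) (cderiv a b u1 t) (cderiv a b v1 t) * \<eta> t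
    + EL_v lam eps (u t) (v t) (u1 t) (v1 t) (cderiv a b u1 t) (cderiv a b v1 t) * \<zeta> t" for t
  have dB: "(B has_real_derivative fs 0 t - L t) (at t within {a..b})" if t: "t \<in> {a..b}" for t
  proof -
    have L: "L t = EL_u lam eps (X 0 0 0 t) (Y 0 0 0 t) (X 0 1 0 t) (Y 0 1 0 t)
          (X 0 (Suc 1) 0 t) (Y 0 (Suc 1) 0 t) * X 1 0 0 t
        + EL_v lam eps (X 0 0 0 t) (Y 0 0 0 t) (X 0 1 0 t) (Y 0 1 0 t)
          (X 0 (Suc 1) 0 t) (Y 0 (Suc 1) 0 t) * Y 1 0 0 t"
      unfolding L_def 0[OF t] 1[OF t] 2[OF t] \<eta>X[OF t] \<zeta>Y[OF t] ..
    \<comment> \<open>The mixed derivative \<open>X 1 1\<close> enters \<open>fs\<close> as the s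
      derivative of \<open>X 0 1\<close> and is used here as the t derivative of
      \<open>X 1 0\<close>; likewise for \<open>Y\<close>. This is the exchange of derivatives
      behind the integration by parts.\<close>
    show ?thesis
      unfolding L fs_def B_def[abs_def]
      by (rule boundary_term_DERIV[where u = "X 0 0 0" and v = "Y 0 0 0" and p = "X 0 1 0"
            and q = "Y 0 1 0" and f = "X 1 0 0" and g = "Y 1 0 0"])
         (use X(4)[OF S0 t] Y(4)[OF S0 t] w[OF S0 t] in simp_all)
  qed
  have "((\<lambda>t. fs 0 t - L t) has_integral B b - B a) {a..b}"
    using ab dB by (intro fundamental_theorem_of_calculus)
      (auto simp: has_real_derivative_iff_has_vector_derivative)
  moreover have "B b - B a = 0" unfolding B_def e0 by simp
  moreover have "(fs 0 has_integral integral {a..b} (fs 0)) {a..b}"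
    using slice[OF contfs S0] integrable_continuous_real integrable_integral by blast
  \<comment> \<open>Writing \<open>L\<close> as this difference gives its integrability together
    with the value of its integral.\<close>
  ultimately have "((\<lambda>t. fs 0 t - (fs 0 t - L t)) has_integral integral {a..b} (fs 0) - 0) {a..b}"
    by (intro has_integral_diff) auto
  then have "integral {a..b} (fs 0) = integral {a..b} L"
    by (simp add: integral_unique)
  then show ?thesis using E unfolding L_def by simp
qed

section \<open>Affine variations of an admissible curve\<close>

lemma Psi_mem_de_sitter_yz_pos_iff: "Psi x y \<in> de_sitter_yz_pos \<longleftrightarrow> cosh x * sin y - sinh x > 0"
  using Psi_in_de_sitter[of x y] by (simp add: de_sitter_yz_pos_def Psi_def)

text \<open>Lying in the half-space and being non-degenerate of the given type are strict
  inequalities, continuous in (s, t), so they survive for small s uniformly in t.\<close>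

lemma linear_variation:
  assumes ab: "a < b" and adm: "admissible a b eps u v"
    and sm: "smooth1 a b f" "smooth1 a b g"
    and ends: "f a = 0" "f b = 0" "g a = 0" "g b = 0"
  obtains \<delta> where "variation a b eps u v \<delta> (\<lambda>s t. u t + s * f t) (\<lambda>s t. v t + s * g t)"
proof -
  have su: "smooth1 a b u" and sv: "smooth1 a b v"
    and pos: "\<And>t. t \<in> {a..b} \<Longrightarrow> cosh (u t) * sin (v t) - sinh (u t) > 0"
    and nd: "nondegenerate a b eps (\<lambda>t. Psi (u t) (v t))"
    using adm unfolding admissible_def Psi_mem_de_sitter_yz_pos_iff by auto
  note eps = nondegenerate_sign[OF nd]
  define u1 v1 f1 g1 where "u1 = cderiv a b u" "v1 = cderiv a b v" "f1 = cderiv a b f" "g1 = cderiv a b g"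
  note d1 = this
  have cont: "continuous_on (UNIV \<times> {a..b}) (\<lambda>z. h (snd z))"
    if "smooth1 a b h" for h :: "real \<Rightarrow> real"
    by (rule continuous_on_compose2[OF smooth1_continuous_on[OF ab that]])
       (auto intro!: continuous_intros)
  note c = su sv sm su[THEN smooth1_cderiv[OF ab]] sv[THEN smooth1_cderiv[OF ab]]
    sm[THEN smooth1_cderiv[OF ab]]
  note c = c[folded d1, THEN cont]
  \<comment> \<open>Positivity of \<open>F\<close> is the half-space condition and positivity of
    \<open>G\<close> the non-degeneracy of the varied curve.\<close>
  define F where "F z = cosh (u (snd z) + fst z * f (snd z)) * sin (v (snd z) + fst z * g (snd z))
      - sinh (u (snd z) + fst z * f (snd z))" for z :: "real \<times> real"
  define G where "G z = speed_sq eps (u (snd z) + fst z * f (snd z))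
      (u1 (snd z) + fst z * f1 (snd z)) (v1 (snd z) + fst z * g1 (snd z))" for z :: "real \<times> real"
  have "continuous_on (UNIV \<times> {a..b}) F"
    unfolding F_def by (intro continuous_intros c)
  then obtain d where d: "d > 0" "\<And>s t. \<bar>s\<bar> < d \<Longrightarrow> t \<in> {a..b} \<Longrightarrow> F (s, t) > 0"
    using positive_near_compact_slice[of a b F] ab pos by (auto simp: F_def)
  have "continuous_on (UNIV \<times> {a..b}) G"
    unfolding G_def speed_sq_def by (intro continuous_intros c)
  moreover have "G (0, t) > 0" if "t \<in> {a..b}" for t
    using nd that nondegenerate_iff_speed_sq[OF ab eps su sv] by (simp add: G_def d1)
  ultimately obtain e where e: "e > 0" "\<And>s t. \<bar>s\<bar> < e \<Longrightarrow> t \<in> {a..b} \<Longrightarrow> G (s, t) > 0"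
    using positive_near_compact_slice[of a b G] ab by (metis less_imp_le)
  have cd: "cderiv a b (\<lambda>t. h t + s * k t) t = cderiv a b h t + s * cderiv a b k t"
    if "smooth1 a b h" "smooth1 a b k" "t \<in> {a..b}" for h k s t
    by (rule cderiv_real_eq[OF ab that(3)])
       (use that smooth1_DERIV[OF ab] in \<open>auto intro!: derivative_intros DERIV_cmult\<close>)
  have adm_s: "admissible a b eps (\<lambda>t. u t + s * f t) (\<lambda>t. v t + s * g t)" if "\<bar>s\<bar> < min d e" for s
  proof -
    have sm': "smooth1 a b (\<lambda>t. u t + s * f t)" "smooth1 a b (\<lambda>t. v t + s * g t)"
      using su sv sm smooth1_add_scaled by auto
    have "nondegenerate a b eps (\<lambda>t. Psi (u t + s * f t) (v t + s * g t))"
      unfolding nondegenerate_iff_speed_sq[OF ab eps sm']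
      using e(2)[of s] that cd su sv sm by (auto simp: G_def d1)
    moreover have "\<forall>t\<in>{a..b}. Psi (u t + s * f t) (v t + s * g t) \<in> de_sitter_yz_pos"
      unfolding Psi_mem_de_sitter_yz_pos_iff using d(2)[of s] that by (auto simp: F_def)
    ultimately show ?thesis using sm' unfolding admissible_def by blast
  qed
  have "admissible a b eps (\<lambda>t. u t + s * f t) (\<lambda>t. v t + s * g t)"
    if "s \<in> {- min d e<..<min d e}" for s
  proof -
    have "\<bar>s\<bar> < min d e"
      using that by (auto simp: min_def split: if_splits)
    then show ?thesis using adm_s by blast
  qed
  then have "variation a b eps u v (min d e) (\<lambda>s t. u t + s * f t) (\<lambda>s t. v t + s * g t)"
    unfolding variation_def using d(1) e(1) ends smooth2_linear[OF ab] su sv sm by simp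
  then show ?thesis by (rule that)
qed

section \<open>Catenaries\<close>

text \<open>Polynomial fields, realized by \<open>linear_variation\<close>, test the first variation
  in one direction; in the other its integrand vanishes for every family.\<close>

lemma catenary_iff_EL:
  assumes ab: "a < b" and adm: "admissible a b eps u v"
  defines "u1 \<equiv> cderiv a b u" and "v1 \<equiv> cderiv a b v"
  shows "catenary_yz lam a b eps u v \<longleftrightarrow> (\<forall>t\<in>{a..b}.
    EL_u lam eps (u t) (v t) (u1 t) (v1 t) (cderiv a b u1 t) (cderiv a b v1 t) = 0 \<and>
    EL_v lam eps (u t) (v t) (u1 t) (v1 t) (cderiv a b u1 t) (cderiv a b v1 t) = 0)"
    (is "_ \<longleftrightarrow> (\<forall>t\<in>_. ?P t = 0 \<and> ?Q t = 0)")
proof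
  have su: "smooth1 a b u" and sv: "smooth1 a b v"
    and nd: "nondegenerate a b eps (\<lambda>t. Psi (u t) (v t))"
    using adm unfolding admissible_def by auto
  note fv = first_variation[OF ab su sv, folded u1_def v1_def]
  {
    assume cat: "catenary_yz lam a b eps u v"
    have w: "speed_sq eps (u t) (u1 t) (v1 t) > 0" if "t \<in> {a..b}" for t
      using nd that nondegenerate_iff_speed_sq[OF ab nondegenerate_sign[OF nd] su sv]
      by (simp add: u1_def v1_def)
    note s1 = su[THEN smooth1_cderiv[OF ab], folded u1_def] sv[THEN smooth1_cderiv[OF ab], folded v1_def]
    note cont = smooth1_continuous_on[OF ab su] smooth1_continuous_on[OF ab sv]
      smooth1_continuous_on[OF ab s1(1)] smooth1_continuous_on[OF ab s1(2)]
      smooth1_continuous_on[OF ab smooth1_cderiv[OF ab s1(1)]]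
      smooth1_continuous_on[OF ab smooth1_cderiv[OF ab s1(2)]]
    have cw: "continuous_on {a..b} (\<lambda>t. speed_sq eps (u t) (u1 t) (v1 t))"
      unfolding speed_sq_def by (intro continuous_intros cont)
    \<comment> \<open>The divisions by the speed are thus continuous, as the fundamental lemma
      demands of both expressions.\<close>
    have nz: "\<forall>t\<in>{a..b}. speed_sq eps (u t) (u1 t) (v1 t) \<noteq> 0" using w by force
    have cP: "continuous_on {a..b} ?P"
      unfolding EL_u_def Let_def height_def speed_sq_deriv_def
      by (intro continuous_intros cont cw) (use nz in simp_all)
    have cQ: "continuous_on {a..b} ?Q"
      unfolding EL_v_def Let_def height_def speed_sq_deriv_def
      by (intro continuous_intros cont cw) (use nz in simp_all)
    have orth: "integral {a..b} (\<lambda>t. ?P t * f t + ?Q t * g t) = 0"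
      if fg: "real_polynomial_function f" "real_polynomial_function g"
        "f a = 0" "f b = 0" "g a = 0" "g b = 0" for f g
    proof -
      obtain \<delta> where \<delta>: "variation a b eps u v \<delta> (\<lambda>s t. u t + s * f t) (\<lambda>s t. v t + s * g t)"
        by (rule linear_variation[OF ab adm smooth1_polynomial[OF fg(1)] smooth1_polynomial[OF fg(2)]
              fg(3-6)])
      have "((\<lambda>s. energy lam a b eps (\<lambda>t. u t + s * f t) (\<lambda>t. v t + s * g t)) has_real_derivative
          integral {a..b} (\<lambda>t. ?P t * f t + ?Q t * g t)) (at 0)"
        by (rule fv[OF \<delta>]) (auto intro!: derivative_eq_intros)
      moreover have "((\<lambda>s. energy lam a b eps (\<lambda>t. u t + s * f t) (\<lambda>t. v t + s * g t))
          has_real_derivative 0) (at 0)"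
        using cat[unfolded catenary_yz_def, THEN conjunct2, rule_format, OF \<delta>] .
      ultimately show ?thesis by (rule DERIV_unique)
    qed
    \<comment> \<open>Setting one of the two fields to zero separates the two equations.\<close>
    have z: "real_polynomial_function (\<lambda>t::real. 0)" by (rule real_polynomial_function.intros)
    have "?P t = 0" if "t \<in> {a..b}" for t
      by (rule polynomial_orthogonal_imp_zero[OF ab cP _ that]) (use orth[OF _ z] in simp)
    moreover have "?Q t = 0" if "t \<in> {a..b}" for t
      by (rule polynomial_orthogonal_imp_zero[OF ab cQ _ that]) (use orth[OF z] in simp)
    ultimately show "\<forall>t\<in>{a..b}. ?P t = 0 \<and> ?Q t = 0" by blast
  next
    assume EL: "\<forall>t\<in>{a..b}. ?P t = 0 \<and> ?Q t = 0"
    have "((\<lambda>s. energy lam a b eps (U s) (V s)) has_real_derivative 0) (at 0)"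
      if var: "variation a b eps u v \<delta> U V" for \<delta> U V
    proof -
      have "\<delta> > 0" "smooth2 {-\<delta><..<\<delta>} a b U" "smooth2 {-\<delta><..<\<delta>} a b V"
        using var unfolding variation_def by auto
      then obtain \<eta> \<zeta> where d: "\<And>t. t \<in> {a..b} \<Longrightarrow> ((\<lambda>s. U s t) has_real_derivative \<eta> t) (at 0)"
        "\<And>t. t \<in> {a..b} \<Longrightarrow> ((\<lambda>s. V s t) has_real_derivative \<zeta> t) (at 0)"
        using smooth2_has_derivative_at_0 by metis
      have "integral {a..b} (\<lambda>t. ?P t * \<eta> t + ?Q t * \<zeta> t) = integral {a..b} (\<lambda>t. 0)"
        by (rule integral_cong) (use EL in simp)
      then show ?thesis using fv[OF var d, where lam = lam] by simp
    qed
    then show "catenary_yz lam a b eps u v"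
      using adm unfolding catenary_yz_def by blast
  }
qed

theorem theorem4p1:
  fixes lam a b eps :: real and u v :: "real \<Rightarrow> real" and \<gamma> :: "real \<Rightarrow> real^3"
  assumes "a < b"
    and "smooth1 a b u" and "smooth1 a b v"
    and "\<gamma> = (\<lambda>t. Psi (u t) (v t))"
    and "nondegenerate a b eps \<gamma>"
    and "\<forall>t\<in>{a..b}. \<gamma> t \<in> de_sitter_yz_pos"
    and "\<forall>t\<in>{a..b}. cosh (u t) * sin (v t) - sinh (u t) + lam \<noteq> 0"
  shows "catenary_yz lam a b eps u v \<longleftrightarrow>
    (\<forall>t\<in>{a..b}. curvature a b eps \<gamma> t =
       - (cderiv a b v t * cosh (u t) * (sinh (u t) * sin (v t) - cosh (u t))
            + cderiv a b u t * cos (v t))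
         / ((cosh (u t) * sin (v t) - sinh (u t) + lam) * speed a b eps \<gamma> t))"
proof -
  have adm: "admissible a b eps u v"
    using assms unfolding admissible_def by blast
  note eps = nondegenerate_sign[OF assms(5)]
  define u1 v1 where "u1 = cderiv a b u" "v1 = cderiv a b v"
  note d1 = this
  have w: "speed_sq eps (u t) (u1 t) (v1 t) > 0" if "t \<in> {a..b}" for t
    using assms(4,5) that nondegenerate_iff_speed_sq[OF assms(1) eps assms(2,3)] by (simp add: d1)
  have "EL_u lam eps (u t) (v t) (u1 t) (v1 t) (cderiv a b u1 t) (cderiv a b v1 t) = 0 \<and>
      EL_v lam eps (u t) (v t) (u1 t) (v1 t) (cderiv a b u1 t) (cderiv a b v1 t) = 0 \<longleftrightarrow>
      curvature a b eps \<gamma> t = curv_rhs lam eps (u t) (v t) (u1 t) (v1 t)"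
    if t: "t \<in> {a..b}" for t
  proof -
    have h: "height lam (u t) (v t) \<noteq> 0" using assms(7) t by (simp add: height_def)
    \<comment> \<open>Both expressions are multiples of one curvature defect, by \<open>v1 t\<close>
      and \<open>- u1 t\<close> up to a common nonzero factor; since these do not vanish together,
      both expressions are zero exactly when the defect is.\<close>
    have "u1 t \<noteq> 0 \<or> v1 t \<noteq> 0" using w[OF t] by (auto simp: speed_sq_def)
    moreover have "eps \<noteq> 0" using eps by auto
    moreover have "cosh (u t) \<noteq> 0" using cosh_real_pos[of "u t"] by linarith
    moreover have "curvature a b eps \<gamma> t = eps * Psi_det (u t) (u1 t) (v1 t) (cderiv a b u1 t)
        (cderiv a b v1 t) / sqrt (speed_sq eps (u t) (u1 t) (v1 t)) ^ 3"
      unfolding assms(4) d1 by (rule curvature_Psi[OF assms(1) t assms(2,3)])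
    ultimately show ?thesis
      unfolding EL_eq_curvature_defect[OF eps h w[OF t]] using h by auto
  qed
  moreover have "speed a b eps \<gamma> t = sqrt (speed_sq eps (u t) (u1 t) (v1 t))" if "t \<in> {a..b}" for t
    unfolding assms(4) d1
    using speed_Psi[OF assms(1) that smooth1_DERIV smooth1_DERIV] assms(1-3) that by blast
  ultimately show ?thesis
    unfolding catenary_iff_EL[OF assms(1) adm, folded d1] d1(1)[symmetric] d1(2)[symmetric]
    by (simp add: curv_rhs_def height_def)
qed

end
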